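(* Suppose $f:S^1\to[0,\infty)$ is continuous and of bounded variation, and $0<p_1<p_2\le\infty$. Then $$\mathbf{ucat}^{p_1}(f)\le\mathbf{ucat}^{p_2}(f).$$
   Context: A continuous function $u:X\to[0,\infty)$ on a topological space is unimodal if there is $M>0$ such that the superlevel set $u^{-1}[c,\infty)$ is contractible for $0<c\le M$ and empty for $c>M$. For $p\in(0,\infty)$, the unimodal $p$-category $\mathbf{ucat}^p(f)$ of $f:X\to[0,\infty)$ is the minimum number $n$ of unimodal functions $u_1,\dots,u_n:X\to[0,\infty)$ such that pointwise $f=\left(\sum_{i=1}^n u_i^p\right)^{1/p}$; $\mathbf{ucat}^\infty(f)$ is the minimum number $n$ of unimodal functions such that pointwise $f=\max_{1\le i\le n}u_i$. The value is $\infty$ if no such $n$ exists. (For $f\equiv 0$ the value is $0$.) $f:S^1\to[0,\infty)$ has bounded variation if the function $[0,1]\to[0,\infty)$, $t\mapsto f(\exp(2\pi i t))$, has bounded variation. *)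

theory Defs
  imports "HOL-Analysis.Analysis"
begin

definition superlevel :: "'a topology \<Rightarrow> ('a \<Rightarrow> real) \<Rightarrow> real \<Rightarrow> 'a set" where
  "superlevel X u c = {x \<in> topspace X. c \<le> u x}"

text \<open>
  A contractible space is nonempty (homotopy equivalent to a point), whereas
  \<^const>\<open>contractible_space\<close> also holds of the empty space; nonemptiness is therefore
  required separately.  In particular the zero function is not unimodal.
\<close>

definition unimodal :: "'a topology \<Rightarrow> ('a \<Rightarrow> real) \<Rightarrow> bool" where
  "unimodal X u \<longleftrightarrow>
     continuous_map X euclideanreal u \<and>
     (\<forall>x\<in>topspace X. 0 \<le> u x) \<and>
     (\<exists>M>0.
        (\<forall>c. 0 < c \<and> c \<le> M \<longrightarrow>
           superlevel X u c \<noteq> {} \<and> contractible_space (subtopology X (superlevel X u c))) \<and>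
        (\<forall>c>M. superlevel X u c = {}))"

text \<open>
  Inserting 0 into the set whose maximum is taken only matters for \<open>n = 0\<close>, where it fixes the
  empty maximum to be 0; otherwise it is harmless, as the \<open>u i\<close> are nonnegative.
\<close>

definition unimodal_decomposition ::
    "ennreal \<Rightarrow> 'a topology \<Rightarrow> ('a \<Rightarrow> real) \<Rightarrow> nat \<Rightarrow> (nat \<Rightarrow> 'a \<Rightarrow> real) \<Rightarrow> bool" where
  "unimodal_decomposition p X f n u \<longleftrightarrow>
     (\<forall>i\<in>{1..n}. unimodal X (u i)) \<and>
     (\<forall>x\<in>topspace X.
        f x = (if p = \<infinity> then Max (insert 0 ((\<lambda>i. u i x) ` {1..n}))
               else (\<Sum>i=1..n. u i x powr enn2real p) powr (1 / enn2real p)))"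

text \<open>
  The infimum in \<^typ>\<open>enat\<close> is the minimum of a nonempty set and \<open>\<infinity>\<close> for the empty set.
  Only exponents \<open>p > 0\<close> are meaningful.
\<close>

definition ucat :: "ennreal \<Rightarrow> 'a topology \<Rightarrow> ('a \<Rightarrow> real) \<Rightarrow> enat" where
  "ucat p X f = Inf {enat n | n. \<exists>u. unimodal_decomposition p X f n u}"

definition has_bounded_variation :: "real \<Rightarrow> real \<Rightarrow> (real \<Rightarrow> real) \<Rightarrow> bool" where
  "has_bounded_variation a b g \<longleftrightarrow>
     bdd_above {\<Sum>i<n. \<bar>g (t (Suc i)) - g (t i)\<bar> | n t.
       t 0 = a \<and> t n = b \<and> (\<forall>i<n. t i \<le> t (Suc i))}"

abbreviation S1 :: "complex set" where
  "S1 \<equiv> sphere 0 1"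

definition circle_bounded_variation :: "(complex \<Rightarrow> real) \<Rightarrow> bool" where
  "circle_bounded_variation f \<longleftrightarrow>
     has_bounded_variation 0 1 (\<lambda>t. f (exp (2 * of_real pi * \<i> * of_real t)))"

end

theory Submission
  imports Defs
begin

text \<open>
  A decomposition of \<open>f\<close> into \<open>n\<close> unimodal functions for the exponent \<open>p2\<close> is turned into one with
  at most \<open>n\<close> functions for \<open>p1\<close>. As powers of unimodal functions are unimodal, this means
  writing \<open>f powr p1\<close> as a sum of at most \<open>n\<close> unimodal functions. The case \<open>n \<le> 1\<close> is trivial, so
  let \<open>n \<ge> 2\<close>.

  Cut the circle at a maximum point of each \<open>u i\<close>. On an arc without such points in its interior
  each \<open>u i\<close> first falls and then rises, because its superlevel sets are connected
  (\<open>unimodal_valley\<close>). So the sum of the \<open>u i powr p2\<close> is on that arc the sum of a falling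
  function \<open>D\<close> and a rising function \<open>R\<close>, both nonnegative. This local property is inherited by
  powers with exponent \<open>q \<le> 1\<close>, since \<open>(D + R) powr q - D powr q\<close> still rises by concavity
  (\<open>fall_rise_sum_powr\<close>); with \<open>q = p1 / p2\<close> it holds for \<open>f powr p1\<close>. For \<open>p2 = \<infinity>\<close> the maximum
  of the \<open>u i\<close> is itself a valley on each arc, and then so is its power.

  Conversely, at least two arcs with this local property yield a global decomposition. By shifting
  mass from \<open>D\<close> to \<open>R\<close> linearly along an arc one may assume that \<open>D\<close> ends at 0 and \<open>R\<close> starts at 0
  (\<open>fall_rise_sum_vanishing\<close>). Then the rising part of each arc continues with the falling part
  of the next one to a bump supported on two adjacent arcs, and \<open>f powr p1\<close> is the sum of these
  bumps, one for each cut point (\<open>sum_of_bumps\<close>). Extra cuts bring their number to exactly \<open>n\<close>;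
  bumps that vanish are dropped.
\<close>

section \<open>Valleys and sums of a falling and a rising function\<close>

text \<open>
  This is quasiconvexity. For a continuous function on a compact interval it says that the
  function falls up to some point and rises from there on; monotone functions are included.
\<close>

definition valley_on :: "real \<Rightarrow> real \<Rightarrow> (real \<Rightarrow> real) \<Rightarrow> bool" where
  "valley_on s t g \<longleftrightarrow> (\<forall>x y w. s \<le> x \<and> x \<le> y \<and> y \<le> w \<and> w \<le> t \<longrightarrow> g y \<le> max (g x) (g w))"

text \<open>
  This condition replaces unimodality in all local arguments: unlike being a valley it is
  stable under sums, and it survives concave rescaling.
\<close>

definition fall_rise_sum :: "real \<Rightarrow> real \<Rightarrow> (real \<Rightarrow> real) \<Rightarrow> bool" where
  "fall_rise_sum s t g \<longleftrightarrow>
     (\<exists>D R. continuous_on {s..t} D \<and> antimono_on {s..t} D \<and>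
            continuous_on {s..t} R \<and> mono_on {s..t} R \<and>
            (\<forall>x\<in>{s..t}. 0 \<le> D x \<and> 0 \<le> R x \<and> g x = D x + R x))"

lemma valley_on_powr:
  assumes "valley_on s t g" "\<And>x. x \<in> {s..t} \<Longrightarrow> 0 \<le> g x" "0 < p"
  shows "valley_on s t (\<lambda>x. g x powr p)"
  unfolding valley_on_def
proof (intro allI impI)
  fix x y w assume h: "s \<le> x \<and> x \<le> y \<and> y \<le> w \<and> w \<le> t"
  then have "g y \<le> max (g x) (g w)" using assms(1) unfolding valley_on_def by blast
  then have "g y \<le> g x \<or> g y \<le> g w" by (auto simp: max_def split: if_splits)
  moreover have "0 \<le> g y" using assms(2) h by auto
  ultimately have "g y powr p \<le> g x powr p \<or> g y powr p \<le> g w powr p"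
    using assms(3) by (meson less_eq_real_def powr_mono2)
  then show "g y powr p \<le> max (g x powr p) (g w powr p)" by auto
qed

text \<open>
  Quasiconvexity passes to maxima, so for the exponent \<open>\<infinity>\<close> the function \<open>f\<close> itself is a valley
  between the peaks; for a finite exponent only its power is a sum of valleys.
\<close>

lemma valley_on_Max:
  assumes "finite I" "I \<noteq> {}" "\<And>i. i \<in> I \<Longrightarrow> valley_on s t (g i)"
  shows "valley_on s t (\<lambda>x. Max ((\<lambda>i. g i x) ` I))"
  unfolding valley_on_def
proof (intro allI impI)
  fix x y w assume h: "s \<le> x \<and> x \<le> y \<and> y \<le> w \<and> w \<le> t"
  let ?m = "\<lambda>x. Max ((\<lambda>i. g i x) ` I)"
  have "?m y \<in> (\<lambda>i. g i y) ` I" using assms by (intro Max_in) auto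
  then obtain i where i: "i \<in> I" "?m y = g i y" by auto
  have "g i y \<le> max (g i x) (g i w)" using assms(3)[OF i(1)] h unfolding valley_on_def by blast
  also have "\<dots> \<le> max (?m x) (?m w)"
    using assms i by (intro max.mono Max_ge) auto
  finally show "?m y \<le> max (?m x) (?m w)" using i by simp
qed

text \<open>
  Cut the valley at a minimum point \<open>z\<close>: the falling part is the function frozen after \<open>z\<close>, the
  rising part is what it gains after \<open>z\<close>.
\<close>

lemma valley_imp_fall_rise_sum:
  assumes "continuous_on {s..t} g" "valley_on s t g" "\<And>x. x \<in> {s..t} \<Longrightarrow> 0 \<le> g x" "s \<le> t"
  shows "fall_rise_sum s t g"
proof -
  obtain z where z: "z \<in> {s..t}" "\<And>x. x \<in> {s..t} \<Longrightarrow> g z \<le> g x"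
    using continuous_attains_inf[of "{s..t}" g] assms by auto
  have v: "g y \<le> max (g x) (g w)" if "s \<le> x" "x \<le> y" "y \<le> w" "w \<le> t" for x y w
    using assms(2) that unfolding valley_on_def by blast
  have z': "s \<le> z" "z \<le> t" using z by auto
  show ?thesis unfolding fall_rise_sum_def
  proof (intro exI conjI ballI)
    show "continuous_on {s..t} (\<lambda>x. g (min x z))" "continuous_on {s..t} (\<lambda>x. g (max x z) - g z)"
      using z by (auto intro!: continuous_intros continuous_on_compose2[OF assms(1)])
    show "antimono_on {s..t} (\<lambda>x. g (min x z))"
    proof (intro monotone_onI)
      fix x y assume h: "x \<in> {s..t}" "y \<in> {s..t}" "x \<le> y"
      have "g (min y z) \<le> max (g (min x z)) (g z)" using h z by (intro v) auto
      moreover have "g z \<le> g (min x z)" using h z by auto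
      ultimately show "g (min y z) \<le> g (min x z)" by simp
    qed
    show "mono_on {s..t} (\<lambda>x. g (max x z) - g z)"
    proof (intro monotone_onI)
      fix x y assume h: "x \<in> {s..t}" "y \<in> {s..t}" "x \<le> y"
      have "g (max x z) \<le> max (g z) (g (max y z))" using h z by (intro v) auto
      moreover have "g z \<le> g (max y z)" using h z by auto
      ultimately show "g (max x z) - g z \<le> g (max y z) - g z" by simp
    qed
    fix x assume x: "x \<in> {s..t}"
    show "0 \<le> g (min x z)" "0 \<le> g (max x z) - g z" using x z assms(3) by (auto simp: min_def max_def)
    show "g x = g (min x z) + (g (max x z) - g z)" by (auto simp: min_def max_def)
  qed
qed

lemma fall_rise_sum_sum:
  assumes "\<And>i. i \<in> I \<Longrightarrow> fall_rise_sum s t (g i)"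
  shows "fall_rise_sum s t (\<lambda>x. \<Sum>i\<in>I. g i x)"
proof -
  have "\<forall>i\<in>I. \<exists>D R. continuous_on {s..t} D \<and> antimono_on {s..t} D \<and>
            continuous_on {s..t} R \<and> mono_on {s..t} R \<and>
            (\<forall>x\<in>{s..t}. 0 \<le> D x \<and> 0 \<le> R x \<and> g i x = D x + R x)"
    using assms unfolding fall_rise_sum_def by blast
  then obtain D R where DR: "\<And>i. i \<in> I \<Longrightarrow> continuous_on {s..t} (D i) \<and> antimono_on {s..t} (D i) \<and>
            continuous_on {s..t} (R i) \<and> mono_on {s..t} (R i) \<and>
            (\<forall>x\<in>{s..t}. 0 \<le> D i x \<and> 0 \<le> R i x \<and> g i x = D i x + R i x)"
    by metis
  show ?thesis unfolding fall_rise_sum_def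
  proof (intro exI conjI ballI)
    show "continuous_on {s..t} (\<lambda>x. \<Sum>i\<in>I. D i x)" "continuous_on {s..t} (\<lambda>x. \<Sum>i\<in>I. R i x)"
      using DR by (auto intro!: continuous_intros)
    show "antimono_on {s..t} (\<lambda>x. \<Sum>i\<in>I. D i x)" "mono_on {s..t} (\<lambda>x. \<Sum>i\<in>I. R i x)"
      using DR by (auto intro!: monotone_onI sum_mono simp: monotone_on_def)
    fix x assume x: "x \<in> {s..t}"
    show "0 \<le> (\<Sum>i\<in>I. D i x)" "0 \<le> (\<Sum>i\<in>I. R i x)" using DR x by (auto intro!: sum_nonneg)
    show "(\<Sum>i\<in>I. g i x) = (\<Sum>i\<in>I. D i x) + (\<Sum>i\<in>I. R i x)"
      unfolding sum.distrib[symmetric] using DR x by (intro sum.cong) auto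
  qed
qed

text \<open>
  By concavity of \<open>y \<mapsto> y powr q\<close>, a fixed increment \<open>r\<close> gains less the higher it starts.
\<close>

lemma powr_increment_antimono:
  fixes q r x y :: real
  assumes "0 < q" "q \<le> 1" "0 \<le> r" "0 \<le> x" "x \<le> y"
  shows "(y + r) powr q - y powr q \<le> (x + r) powr q - x powr q"
proof (rule DERIV_nonpos_imp_decreasing_open[OF assms(5)])
  show "continuous_on {x..y} (\<lambda>z. (z + r) powr q - z powr q)"
    using assms by (intro continuous_intros continuous_on_powr') auto
  fix z assume z: "x < z" "z < y"
  have "((\<lambda>z. (z + r) powr q - z powr q) has_real_derivative
          q * (z + r) powr (q - 1) - q * z powr (q - 1)) (at z)"
    using assms z by (auto intro!: derivative_eq_intros)
  moreover have "(z + r) powr (q - 1) \<le> z powr (q - 1)"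
    using assms z by (intro powr_mono2') auto
  then have "q * (z + r) powr (q - 1) - q * z powr (q - 1) \<le> 0"
    using assms(1) by simp
  ultimately show "\<exists>d. ((\<lambda>z. (z + r) powr q - z powr q) has_real_derivative d) (at z) \<and> d \<le> 0"
    by blast
qed

text \<open>
  If \<open>g = D + R\<close>, let \<open>D powr q\<close> be the new falling part. The rest,
  \<open>(D + R) powr q - D powr q\<close>, is the gain from adding \<open>R\<close> on top of \<open>D\<close>; it rises because \<open>R\<close>
  rises and because, by concavity, it profits from a smaller \<open>D\<close>.
\<close>

lemma fall_rise_sum_powr:
  assumes "fall_rise_sum s t g" "0 < q" "q \<le> 1"
  shows "fall_rise_sum s t (\<lambda>x. g x powr q)"
proof -
  obtain D R where DR: "continuous_on {s..t} D" "antimono_on {s..t} D"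
            "continuous_on {s..t} R" "mono_on {s..t} R"
            "\<And>x. x \<in> {s..t} \<Longrightarrow> 0 \<le> D x \<and> 0 \<le> R x \<and> g x = D x + R x"
    using assms(1) unfolding fall_rise_sum_def by blast
  show ?thesis unfolding fall_rise_sum_def
  proof (intro exI conjI ballI)
    show "continuous_on {s..t} (\<lambda>x. D x powr q)"
      using DR assms(2) by (intro continuous_on_powr' continuous_intros) auto
    show "continuous_on {s..t} (\<lambda>x. (D x + R x) powr q - D x powr q)"
      using DR assms(2) by (intro continuous_on_powr' continuous_intros) auto
    show "antimono_on {s..t} (\<lambda>x. D x powr q)"
      using DR assms(2) by (auto intro!: monotone_onI powr_mono2 simp: monotone_on_def)
    show "mono_on {s..t} (\<lambda>x. (D x + R x) powr q - D x powr q)"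
    proof (intro monotone_onI)
      fix x y assume h: "x \<in> {s..t}" "y \<in> {s..t}" "x \<le> y"
      have D: "D y \<le> D x" "0 \<le> D y" and R: "R x \<le> R y" "0 \<le> R x"
        using DR h by (auto simp: monotone_on_def)
      have "(D x + R x) powr q - D x powr q \<le> (D y + R x) powr q - D y powr q"
        using powr_increment_antimono[of q "R x" "D y" "D x"] D R assms by auto
      also have "\<dots> \<le> (D y + R y) powr q - D y powr q"
        using D R assms by (auto intro!: powr_mono2)
      finally show "(D x + R x) powr q - D x powr q \<le> (D y + R y) powr q - D y powr q" .
    qed
    fix x assume x: "x \<in> {s..t}"
    show "0 \<le> D x powr q" by simp
    show "0 \<le> (D x + R x) powr q - D x powr q" using DR(5)[OF x] assms by (auto intro!: powr_mono2)
    show "g x powr q = D x powr q + ((D x + R x) powr q - D x powr q)" using DR(5)[OF x] by simp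
  qed
qed

text \<open>
  Any amount may be moved from \<open>D\<close> to \<open>R\<close> at a steady rate without spoiling monotonicity.
  The linear transfer \<open>e\<close> below first returns the initial value of \<open>R\<close> to \<open>D\<close> and then drains \<open>D\<close>
  completely by the end of the interval.
\<close>

lemma fall_rise_sum_vanishing:
  assumes "fall_rise_sum s t g" "s < t"
  obtains D R where "continuous_on {s..t} D" "antimono_on {s..t} D" "D t = 0"
    "continuous_on {s..t} R" "mono_on {s..t} R" "R s = 0"
    "\<And>x. x \<in> {s..t} \<Longrightarrow> g x = D x + R x"
proof -
  obtain D R where DR: "continuous_on {s..t} D" "antimono_on {s..t} D"
            "continuous_on {s..t} R" "mono_on {s..t} R"
            "\<And>x. x \<in> {s..t} \<Longrightarrow> 0 \<le> D x \<and> 0 \<le> R x \<and> g x = D x + R x"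
    using assms(1) unfolding fall_rise_sum_def by blast
  define c where "c = D t + R s"
  have c: "c \<ge> 0" using DR(5)[of s] DR(5)[of t] assms(2) unfolding c_def by auto
  define e where "e = (\<lambda>x. c * ((x - s) / (t - s)) - R s)"
  have e: "e x \<le> e y" if "x \<le> y" for x y
    unfolding e_def using c assms(2) that by (intro diff_mono mult_left_mono divide_right_mono) auto
  have ce: "continuous_on {s..t} e" unfolding e_def using assms(2) by (intro continuous_intros) auto
  show ?thesis
  proof (rule that)
    show "continuous_on {s..t} (\<lambda>x. D x - e x)" "continuous_on {s..t} (\<lambda>x. R x + e x)"
      using DR ce by (auto intro!: continuous_intros)
    show "antimono_on {s..t} (\<lambda>x. D x - e x)" "mono_on {s..t} (\<lambda>x. R x + e x)"
      using DR e by (auto intro!: monotone_onI diff_mono add_mono simp: monotone_on_def)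
    show "D t - e t = 0" "R s + e s = 0" using assms(2) by (auto simp: e_def c_def)
    show "g x = (D x - e x) + (R x + e x)" if "x \<in> {s..t}" for x using DR(5)[OF that] by simp
  qed
qed

section \<open>Arcs of the circle\<close>

abbreviation turn :: "real \<Rightarrow> complex" where
  "turn x \<equiv> cis (2 * pi * x)"

lemma turn_eq_iff: "turn x = turn y \<longleftrightarrow> (\<exists>n::int. x = y + of_int n)"
proof -
  have "turn x = turn y \<longleftrightarrow> sin (2 * pi * x) = sin (2 * pi * y) \<and> cos (2 * pi * x) = cos (2 * pi * y)"
    by (auto simp: complex_eq_iff)
  also have "\<dots> \<longleftrightarrow> (\<exists>n::int. 2 * pi * x = 2 * pi * y + 2 * pi * of_int n)"
    by (rule sin_cos_eq_iff)
  also have "\<dots> \<longleftrightarrow> (\<exists>n::int. x = y + of_int n)"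
    by (simp add: distrib_left[symmetric])
  finally show ?thesis .
qed

lemma turn_add_1 [simp]: "turn (x + 1) = turn x"
  unfolding turn_eq_iff by (rule exI[of _ 1]) simp

lemma turn_eq_close:
  assumes "turn x = turn y" "x \<le> y" "y \<le> x + 1"
  shows "y = x \<or> y = x + 1"
proof -
  obtain n :: int where n: "y = x + of_int n" using assms(1)[symmetric] unfolding turn_eq_iff by blast
  then have "0 \<le> n" "n \<le> 1" using assms by auto
  then have "n = 0 \<or> n = 1" by auto
  then show ?thesis using n by auto
qed

lemma inj_on_turn: "inj_on turn {s..<s+1}"
proof (rule linorder_inj_onI)
  fix x y assume "x < y" "x \<in> {s..<s+1}" "y \<in> {s..<s+1}"
  then show "turn x \<noteq> turn y" using turn_eq_close[of x y] by auto
qed auto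

lemma turn_image: "turn ` {s..s+1} = S1"
proof -
  have "z \<in> turn ` {s..<s+1}" if z: "z \<in> S1" for z
  proof -
    obtain a where "z = Complex (cos a) (sin a)"
      using complex_unimodular_polar[of z] z by auto
    then have a: "z = cis a" by (simp add: complex_eq_iff)
    define x where "x = s + frac (a / (2 * pi) - s)"
    have "turn x = turn (a / (2 * pi))" unfolding turn_eq_iff x_def frac_def
      by (rule exI[of _ "- \<lfloor>a / (2 * pi) - s\<rfloor>"]) simp
    then have "turn x = z" using a by simp
    moreover have "x \<in> {s..<s+1}" unfolding x_def using frac_lt_1 by auto
    ultimately show ?thesis by blast
  qed
  then have "turn ` {s..<s+1} = S1" by auto
  moreover have "turn ` {s..<s+1} \<subseteq> turn ` {s..s+1}" by (intro image_mono) auto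
  ultimately show ?thesis by auto
qed

lemma compact_turn_image: "compact (turn ` {s..t})"
  by (intro compact_continuous_image continuous_intros compact_Icc)

text \<open>
  Let \<open>m\<close> be a point where the maximum is attained. If \<open>u\<close> were larger at an interior point \<open>y\<close> of
  an arc \<open>[x, w]\<close> than at both ends, the superlevel set at height \<open>u y\<close> would contain \<open>y\<close> but
  neither end. It also contains \<open>m\<close>, which lies on the complementary arc, so it would be
  disconnected, hence not contractible.
\<close>

lemma unimodal_valley:
  assumes "unimodal (top_of_set S1) u"
  obtains m where "m \<in> S1"
    "\<And>s t. t \<le> s + 1 \<Longrightarrow> \<forall>x\<in>{s<..<t}. turn x \<noteq> m \<Longrightarrow> valley_on s t (\<lambda>x. u (turn x))"
proof -
  from assms obtain M where M: "M > 0"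
    "\<And>c. 0 < c \<Longrightarrow> c \<le> M \<Longrightarrow> superlevel (top_of_set S1) u c \<noteq> {}"
    "\<And>c. 0 < c \<Longrightarrow> c \<le> M \<Longrightarrow>
       contractible_space (subtopology (top_of_set S1) (superlevel (top_of_set S1) u c))"
    "\<And>c. c > M \<Longrightarrow> superlevel (top_of_set S1) u c = {}" and u0: "\<And>x. x \<in> S1 \<Longrightarrow> 0 \<le> u x"
    unfolding unimodal_def by auto
  obtain m where m: "m \<in> S1" "M \<le> u m" using M(2)[of M] M(1) by (auto simp: superlevel_def)
  have le: "u x \<le> M" if "x \<in> S1" for x using M(4)[of "u x"] that
    by (auto simp: superlevel_def not_le[symmetric])
  have conn: "connected {x \<in> S1. c \<le> u x}" if "0 < c" "c \<le> M" for c
  proof -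
    have "S1 \<inter> {x \<in> S1. c \<le> u x} = {x \<in> S1. c \<le> u x}" by auto
    then show ?thesis using M(3)[OF that] contractible_imp_connected
      by (auto simp: superlevel_def subtopology_subtopology)
  qed
  show ?thesis
  proof (rule that[OF m(1)])
    fix s t :: real assume t: "t \<le> s + 1" and mst: "\<forall>x\<in>{s<..<t}. turn x \<noteq> m"
    show "valley_on s t (\<lambda>x. u (turn x))" unfolding valley_on_def
    proof (intro allI impI, rule ccontr)
      fix x y w assume h: "s \<le> x \<and> x \<le> y \<and> y \<le> w \<and> w \<le> t"
        and n: "\<not> u (turn y) \<le> max (u (turn x)) (u (turn w))"
      let ?C = "{z \<in> S1. u (turn y) \<le> u z}"
      let ?A = "turn ` {x..w}" and ?B = "turn ` {w..x+1}"
      have lt: "x < y" "y < w" using h n by (auto simp: less_le)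
      have w: "w \<le> x + 1" using h t by auto
      have "0 < u (turn y)" "u (turn y) \<le> M" using n u0[of "turn x"] le[of "turn y"] by auto
      note C = conn[OF this]
      have xw: "turn x \<notin> ?C" "turn w \<notin> ?C" using n by auto
      have mC: "m \<in> ?C" using m le[of "turn y"] by auto
      (* The two complementary closed arcs with ends x and w meet only in these ends. *)
      have "S1 = ?A \<union> ?B"
        using turn_image[of x] lt w by (simp add: image_Un[symmetric] ivl_disj_un_two_touch)
      then have AB: "?C \<subseteq> ?A \<union> ?B" by blast
      have "?A \<inter> ?B \<inter> ?C = {}"
      proof -
        have "z \<notin> ?C" if zAB: "z \<in> ?A" "z \<in> ?B" for z
        proof -
          obtain a b where ab: "a \<in> {x..w}" "b \<in> {w..x+1}" "z = turn a" "z = turn b" using zAB by blast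
          then have "turn a = turn b" "a \<le> b" "b \<le> a + 1" by simp_all
          then have "b = a \<or> b = a + 1" by (rule turn_eq_close)
          then have "a = w \<or> a = x" using ab by auto
          then show ?thesis using ab xw by blast
        qed
        then show ?thesis by blast
      qed
      moreover have "turn y \<in> ?A \<inter> ?C" using lt by auto
      moreover have "m \<in> ?B \<inter> ?C"
      proof -
        have "m \<notin> turn ` {x<..<w}" using mst h by auto
        moreover have "m \<noteq> turn x" "m \<noteq> turn w" using mC xw by auto
        ultimately have "m \<notin> ?A" by (auto simp: less_le)
        then show ?thesis using mC AB by auto
      qed
      ultimately have "closed ?A \<and> closed ?B \<and> ?C \<subseteq> ?A \<union> ?B \<and> ?A \<inter> ?B \<inter> ?C = {} \<and>
          ?A \<inter> ?C \<noteq> {} \<and> ?B \<inter> ?C \<noteq> {}"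
        using AB compact_turn_image[THEN compact_imp_closed] by blast
      then show False using C unfolding connected_closed by blast
    qed
  qed
qed


section \<open>Gluing bumps\<close>

text \<open>
  A rising piece followed by a falling piece, of total length at most one turn, is unimodal on
  the circle: the superlevel sets are closed arcs that miss the start \<open>s\<close>. If the common value at
  the top \<open>m\<close> is 0, the function vanishes and is not unimodal; the bounds on \<open>v\<close> cover that case.
\<close>

lemma bump_on_circle:
  assumes "s < m" "m < t" "t \<le> s + 1"
    and R: "continuous_on {s..m} R" "mono_on {s..m} R" "R s = 0"
    and D: "continuous_on {m..t} D" "antimono_on {m..t} D" "D t = 0"
    and RD: "R m = D m"
  obtains v where "\<And>y. y \<in> {s..m} \<Longrightarrow> v (turn y) = R y" "\<And>y. y \<in> {m..t} \<Longrightarrow> v (turn y) = D y"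
    "\<And>y. y \<in> {t..s+1} \<Longrightarrow> v (turn y) = 0"
    "\<And>z. z \<in> S1 \<Longrightarrow> 0 \<le> v z \<and> v z \<le> R m"
    "0 < R m \<Longrightarrow> unimodal (top_of_set S1) v"
proof -
  define B where "B = (\<lambda>y. if y \<le> m then R y else if y \<le> t then D y else 0)"
  define v where "v = (\<lambda>z. B (inv_into {s..<s+1} turn z))"
  have Rmono: "R x \<le> R y" if "s \<le> x" "x \<le> y" "y \<le> m" for x y
    using R(2) that by (auto simp: monotone_on_def)
  have Dmono: "D y \<le> D x" if "m \<le> x" "x \<le> y" "y \<le> t" for x y
    using D(2) that by (auto simp: monotone_on_def)
  have Binc: "B x \<le> B y" if "s \<le> x" "x \<le> y" "y \<le> m" for x y
    using Rmono that by (simp add: B_def)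
  have Bdec: "B y \<le> B x" if "m \<le> x" "x \<le> y" for x y
    using Dmono[of x y] Dmono[of x t] that D(3) RD assms(2) by (cases "x = y") (auto simp: B_def)
  have Bs: "B s = 0" using assms R by (simp add: B_def)
  have Be: "B (s + 1) = 0" using assms D by (auto simp: B_def)
  have Bm: "B m = R m" by (simp add: B_def)
  have B0: "0 \<le> B x" "B x \<le> R m" if "x \<in> {s..s+1}" for x
    using Binc[of s x] Binc[of x m] Bdec[of x "s+1"] Bdec[of m x] Bs Be Bm that
    by (cases "x \<le> m"; force)+
  have "continuous_on ({s..m} \<union> ({m..t} \<union> {t..s+1})) B"
    unfolding B_def using R D RD assms
    by (intro continuous_on_cases) (auto intro!: continuous_intros)
  moreover have "{s..m} \<union> ({m..t} \<union> {t..s+1}) = {s..s+1}" using assms by auto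
  ultimately have Bc: "continuous_on {s..s+1} B" by simp
  note inj = inj_on_turn[of s]
  have vB: "v (turn y) = B y" if y: "y \<in> {s..s+1}" for y
  proof (cases "y = s + 1")
    case True
    then have "v (turn y) = v (turn s)" by simp
    also have "\<dots> = B s" unfolding v_def using inj by (subst inv_into_f_f) auto
    finally show ?thesis using True Bs Be by simp
  next
    case False
    then show ?thesis unfolding v_def using inj y by (subst inv_into_f_f) auto
  qed
  (* A full turn is a quotient map, so continuity can be checked on the interval. *)
  have "quotient_map (top_of_set {s..s+1}) (top_of_set S1) turn"
  proof (rule T1_Spaces.continuous_imp_quotient_map)
    show "continuous_map (top_of_set {s..s+1}) (top_of_set S1) turn"
      by (auto intro!: continuous_intros)
    show "turn ` topspace (top_of_set {s..s+1}) = topspace (top_of_set S1)"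
      using turn_image[of s] by simp
  qed (auto simp: compact_space_subtopology Hausdorff_space_subtopology)
  moreover have "continuous_map (top_of_set {s..s+1}) euclideanreal (v \<circ> turn)"
    using continuous_on_eq[OF Bc] by (simp add: vB)
  ultimately have vc: "continuous_map (top_of_set S1) euclideanreal v"
    by (rule continuous_compose_quotient_map)
  have vb: "0 \<le> v z" "v z \<le> R m" if z: "z \<in> S1" for z
  proof -
    obtain y where "y \<in> {s..s+1}" "z = turn y" using z unfolding turn_image[of s, symmetric] by blast
    then show "0 \<le> v z" "v z \<le> R m" using vB B0 by auto
  qed
  have sup: "superlevel (top_of_set S1) v c = turn ` {y \<in> {s..s+1}. c \<le> B y}" for c
  proof -
    have "superlevel (top_of_set S1) v c = {z \<in> turn ` {s..s+1}. c \<le> v z}"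
      by (simp add: superlevel_def turn_image)
    also have "\<dots> = turn ` {y \<in> {s..s+1}. c \<le> v (turn y)}" by blast
    also have "\<dots> = turn ` {y \<in> {s..s+1}. c \<le> B y}" using vB by (intro arg_cong[of _ _ "image turn"]) auto
    finally show ?thesis .
  qed
  show ?thesis
  proof (rule that[of v])
    show "v (turn y) = R y" if "y \<in> {s..m}" for y using vB[of y] that assms by (auto simp: B_def)
    show "v (turn y) = D y" if "y \<in> {m..t}" for y using vB[of y] that assms by (auto simp: B_def)
    show "v (turn y) = 0" if "y \<in> {t..s+1}" for y using vB[of y] that assms by (auto simp: B_def)
    show "0 \<le> v z \<and> v z \<le> R m" if "z \<in> S1" for z using vb that by blast
    assume pos: "0 < R m"
    show "unimodal (top_of_set S1) v" unfolding unimodal_def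
    proof (intro conjI exI[of _ "R m"] allI impI ballI)
      show "continuous_map (top_of_set S1) euclideanreal v" by (rule vc)
      show "0 \<le> v x" if "x \<in> topspace (top_of_set S1)" for x using vb that by simp
      show "0 < R m" by (rule pos)
      show "superlevel (top_of_set S1) v c = {}" if "R m < c" for c
        using vb that by (force simp: superlevel_def)
      fix c assume c: "0 < c \<and> c \<le> R m"
      let ?I = "{y \<in> {s..s+1}. c \<le> B y}"
      show "superlevel (top_of_set S1) v c \<noteq> {}" 
      proof -
        have "m \<in> ?I" using c Bm assms(1-3) by simp
        then show ?thesis unfolding sup by blast
      qed
      have I: "?I \<subseteq> {s<..<s+1}" using Bs Be c by (force simp: less_le)
      have "compact ?I"
      proof -
        have "closed ({s..s+1} \<inter> B -` {c..})"
          using Bc by (intro continuous_closed_preimage) auto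
        then have "compact ({s..s+1} \<inter> ({s..s+1} \<inter> B -` {c..}))"
          by (intro compact_Int_closed) auto
        moreover have "{s..s+1} \<inter> ({s..s+1} \<inter> B -` {c..}) = ?I" by auto
        ultimately show ?thesis by simp
      qed
      moreover have "inj_on turn ?I" using I by (intro inj_on_subset[OF inj]) auto
      ultimately have hom: "?I homeomorphic turn ` ?I"
        by (intro homeomorphic_compact) (auto intro!: continuous_intros)
      have "is_interval ?I" unfolding is_interval_1
      proof (intro ballI allI impI)
        fix a b x assume h: "a \<in> ?I" "b \<in> ?I" "a \<le> x \<and> x \<le> b"
        have "c \<le> B x"
        proof (cases "x \<le> m")
          case True then show ?thesis using Binc[of a x] h by auto
        next
          case False then show ?thesis using Bdec[of x b] h by auto
        qed
        then show "x \<in> ?I" using h by auto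
      qed
      then have "contractible ?I" by (intro convex_imp_contractible) (simp add: is_interval_convex_1)
      then have "contractible (turn ` ?I)" using hom by (rule homeomorphic_contractible)
      moreover have "S1 \<inter> turn ` ?I = turn ` ?I" by auto
      ultimately show "contractible_space (subtopology (top_of_set S1) (superlevel (top_of_set S1) v c))"
        unfolding sup by (simp add: subtopology_subtopology)
    qed
  qed
qed

lemma unimodal_powr:
  assumes "unimodal X u" "0 < r"
  shows "unimodal X (\<lambda>x. u x powr r)"
proof -
  from assms(1) obtain M where u: "continuous_map X euclideanreal u" "\<And>x. x \<in> topspace X \<Longrightarrow> 0 \<le> u x"
    and M: "M > 0"
    "\<And>c. 0 < c \<Longrightarrow> c \<le> M \<Longrightarrow> superlevel X u c \<noteq> {} \<and> contractible_space (subtopology X (superlevel X u c))"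
    "\<And>c. c > M \<Longrightarrow> superlevel X u c = {}"
    unfolding unimodal_def by blast
  have iff: "c powr (1/r) \<le> b \<longleftrightarrow> c \<le> b powr r" if "0 < c" "0 \<le> b" for b c :: real
  proof
    assume "c powr (1/r) \<le> b"
    then have "(c powr (1/r)) powr r \<le> b powr r" using assms(2) by (intro powr_mono2) auto
    then show "c \<le> b powr r" using assms(2) that by (simp add: powr_powr)
  next
    assume "c \<le> b powr r"
    then have "c powr (1/r) \<le> (b powr r) powr (1/r)" using assms(2) that by (intro powr_mono2) auto
    then show "c powr (1/r) \<le> b" using assms(2) that by (simp add: powr_powr)
  qed
  have sup: "superlevel X (\<lambda>x. u x powr r) c = superlevel X u (c powr (1/r))" if "0 < c" for c
    using iff[OF that] u(2) by (auto simp: superlevel_def)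
  have Mr: "c powr (1/r) \<le> M \<longleftrightarrow> c \<le> M powr r" if "0 < c" for c
    using iff[OF that] M(1) by simp
  have "continuous_map X euclideanreal ((\<lambda>y. y powr r) \<circ> u)"
  proof (rule continuous_map_compose)
    show "continuous_map X (top_of_set {0..}) u" using u by (auto simp: continuous_map_in_subtopology)
    show "continuous_map (top_of_set {0..}) euclideanreal (\<lambda>y. y powr r)"
      using assms(2) by (auto intro!: continuous_on_powr' continuous_on_id continuous_on_const)
  qed
  then have "continuous_map X euclideanreal (\<lambda>x. u x powr r)" by (simp add: o_def)
  moreover have "0 < M powr r" using M(1) by simp
  moreover have "superlevel X (\<lambda>x. u x powr r) c \<noteq> {} \<and>
      contractible_space (subtopology X (superlevel X (\<lambda>x. u x powr r) c))" if "0 < c" "c \<le> M powr r" for c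
    using M(2)[of "c powr (1/r)"] Mr[of c] that by (simp add: sup)
  moreover have "superlevel X (\<lambda>x. u x powr r) c = {}" if "M powr r < c" for c
  proof -
    have "0 < c" using that \<open>0 < M powr r\<close> by linarith
    then show ?thesis using M(3)[of "c powr (1/r)"] Mr[of c] that by (simp add: sup)
  qed
  ultimately show ?thesis unfolding unimodal_def by (intro conjI exI[of _ "M powr r"]) auto
qed

text \<open>
  Cut the circle at the points \<open>turn (t k)\<close>. On the \<open>k\<close>-th arc write \<open>F\<close> as \<open>D k + R k\<close> with \<open>D k\<close>
  ending at 0 and \<open>R k\<close> starting at 0. Then \<open>R k\<close> ends at the value of \<open>F\<close> at the next cut, and
  this is also where the following falling part begins, so the two glue to a bump \<open>v k\<close> that is
  supported on two neighbouring arcs. With at least two arcs these fit into one turn, and at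
  each point only the two bumps that share its arc contribute. Bumps of height 0 are dropped.
\<close>

lemma sum_of_bumps:
  fixes F :: "complex \<Rightarrow> real" and t :: "nat \<Rightarrow> real"
  assumes N: "2 \<le> N"
    and t_less: "\<And>k. k < N \<Longrightarrow> t k < t (Suc k)" and tN: "t N = t 0 + 1"
    and F: "\<And>k. k < N \<Longrightarrow> fall_rise_sum (t k) (t (Suc k)) (\<lambda>y. F (turn y))"
  obtains K v where "finite K" "card K \<le> N" "\<And>k. k \<in> K \<Longrightarrow> unimodal (top_of_set S1) (v k)"
    "\<And>x. x \<in> S1 \<Longrightarrow> F x = (\<Sum>k\<in>K. v (k::nat) x)"
proof -
  have t_mono: "t i \<le> t j" if "i \<le> j" "j \<le> N" for i j
    using that
  proof (induction j rule: dec_induct)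
    case (step n)
    then show ?case using t_less[of n] by simp
  qed simp
  define split where "split = (\<lambda>k D R. continuous_on {t k..t (Suc k)} D \<and>
      antimono_on {t k..t (Suc k)} D \<and> D (t (Suc k)) = 0 \<and>
      continuous_on {t k..t (Suc k)} R \<and> mono_on {t k..t (Suc k)} R \<and> R (t k) = 0 \<and>
      (\<forall>y\<in>{t k..t (Suc k)}. F (turn y) = D y + R y))"
  have "\<exists>D R. split k D R" if "k < N" for k
    by (rule fall_rise_sum_vanishing[OF F[OF that] t_less[OF that]]) (unfold split_def, blast)
  then obtain D R where "\<And>k. k < N \<Longrightarrow> split k (D k) (R k)" by metis
  then have D: "\<And>k. k < N \<Longrightarrow> continuous_on {t k..t (Suc k)} (D k)"
      "\<And>k. k < N \<Longrightarrow> antimono_on {t k..t (Suc k)} (D k)" "\<And>k. k < N \<Longrightarrow> D k (t (Suc k)) = 0"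
    and R: "\<And>k. k < N \<Longrightarrow> continuous_on {t k..t (Suc k)} (R k)"
      "\<And>k. k < N \<Longrightarrow> mono_on {t k..t (Suc k)} (R k)" "\<And>k. k < N \<Longrightarrow> R k (t k) = 0"
    and FDR: "\<And>k y. k < N \<Longrightarrow> y \<in> {t k..t (Suc k)} \<Longrightarrow> F (turn y) = D k y + R k y"
    unfolding split_def by blast+
  (* The last bump wraps around: its falling part is that of arc 0, one turn later. *)
  define D' where "D' = (\<lambda>k. if Suc k < N then D (Suc k) else (\<lambda>y. D 0 (y - 1)))"
  define e where "e = (\<lambda>k. if Suc k < N then t (Suc (Suc k)) else t 1 + 1)"
  have peak: "R k (t (Suc k)) = F (turn (t (Suc k)))" if "k < N" for k
    using FDR[of k "t (Suc k)"] D(3) that t_less[of k] by simp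
  have e_gt: "t (Suc k) < e k" if "k < N" for k
    using that t_less[of "Suc k"] t_less[of 0] tN N by (cases "Suc k = N") (auto simp: e_def)
  have e_le: "e k \<le> t k + 1" if "k < N" for k
  proof (cases "Suc k < N")
    case True
    then show ?thesis using t_mono[of "Suc (Suc k)" N] t_mono[of 0 k] tN by (simp add: e_def)
  next
    case False
    then show ?thesis using t_mono[of 1 k] that N by (simp add: e_def)
  qed
  have D': "continuous_on {t (Suc k)..e k} (D' k)" "antimono_on {t (Suc k)..e k} (D' k)"
    "D' k (e k) = 0" "R k (t (Suc k)) = D' k (t (Suc k))" if k: "k < N" for k
  proof -
    have "continuous_on {t (Suc k)..e k} (D' k) \<and> antimono_on {t (Suc k)..e k} (D' k) \<and>
      D' k (e k) = 0 \<and> R k (t (Suc k)) = D' k (t (Suc k))"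
    proof (cases "Suc k < N")
      case True
      then show ?thesis using D[of "Suc k"] peak[OF k] FDR[of "Suc k" "t (Suc k)"] R(3)[of "Suc k"] t_less[of "Suc k"]
        by (simp add: D'_def e_def)
    next
      case False
      then have kN: "Suc k = N" using k by simp
      have t0: "t 0 < t 1" using t_less[of 0] N by simp
      have "continuous_on {t 0 + 1..t 1 + 1} (\<lambda>y. D 0 (y - 1))"
        using N by (intro continuous_on_compose2[OF D(1)[of 0]] continuous_intros) auto
      moreover have "antimono_on {t 0 + 1..t 1 + 1} (\<lambda>y. D 0 (y - 1))"
        using D(2)[of 0] N by (auto simp: monotone_on_def)
      moreover have "R k (t N) = D 0 (t 0)"
        using peak[OF k] FDR[of 0 "t 0"] R(3)[of 0] N t0 by (simp add: kN tN)
      ultimately show ?thesis using D(3)[of 0] N by (simp add: D'_def e_def kN tN)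
    qed
    then show "continuous_on {t (Suc k)..e k} (D' k)" "antimono_on {t (Suc k)..e k} (D' k)"
    "D' k (e k) = 0" "R k (t (Suc k)) = D' k (t (Suc k))" by auto
  qed
  define bump where "bump = (\<lambda>k v. (\<forall>y\<in>{t k..t (Suc k)}. v (turn y) = R k y) \<and>
     (\<forall>y\<in>{t (Suc k)..e k}. v (turn y) = D' k y) \<and>
     (\<forall>y\<in>{e k..t k + 1}. v (turn y) = 0) \<and> (\<forall>z\<in>S1. 0 \<le> v z \<and> v z \<le> R k (t (Suc k))) \<and>
     (0 < R k (t (Suc k)) \<longrightarrow> unimodal (top_of_set S1) v))"
  have "\<exists>v. bump k v" if k: "k < N" for k
    by (rule bump_on_circle[OF t_less[OF k] e_gt[OF k] e_le[OF k] R(1)[OF k] R(2)[OF k] R(3)[OF k]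
          D'(1)[OF k] D'(2)[OF k] D'(3)[OF k] D'(4)[OF k]]) (unfold bump_def, blast)
  then obtain v where "\<And>k. k < N \<Longrightarrow> bump k (v k)" by metis
  then have v: "\<And>k y. k < N \<Longrightarrow> y \<in> {t k..t (Suc k)} \<Longrightarrow> v k (turn y) = R k y"
      "\<And>k y. k < N \<Longrightarrow> y \<in> {t (Suc k)..e k} \<Longrightarrow> v k (turn y) = D' k y"
      "\<And>k y. k < N \<Longrightarrow> y \<in> {e k..t k + 1} \<Longrightarrow> v k (turn y) = 0"
      "\<And>k z. k < N \<Longrightarrow> z \<in> S1 \<Longrightarrow> 0 \<le> v k z \<and> v k z \<le> R k (t (Suc k))"
      "\<And>k. k < N \<Longrightarrow> 0 < R k (t (Suc k)) \<Longrightarrow> unimodal (top_of_set S1) (v k)"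
    unfolding bump_def by blast+
  have total: "F x = (\<Sum>k<N. v k x)" if x: "x \<in> S1" for x
  proof -
    obtain y where y: "y \<in> {t 0..t 0 + 1}" "x = turn y"
      using x unfolding turn_image[of "t 0", symmetric] by blast
    define j where "j = (LEAST k. y \<le> t (Suc k))"
    have ex: "y \<le> t (Suc (N - 1))" using y tN N by simp
    have j: "y \<le> t (Suc j)" "j \<le> N - 1" unfolding j_def using ex by (auto intro: LeastI Least_le)
    have "t j \<le> y"
    proof (cases j)
      case (Suc i)
      then have "\<not> y \<le> t (Suc i)" using not_less_Least[of i "\<lambda>k. y \<le> t (Suc k)"] by (simp add: j_def)
      then show ?thesis using Suc by simp
    qed (use y in auto)
    then have yj: "y \<in> {t j..t (Suc j)}" and jN: "j < N" using j N by auto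
    (* Bump j rises and bump i falls on arc j. *)
    define i where "i = (if j = 0 then N - 1 else j - 1)"
    have i: "i < N" "i \<noteq> j" using jN N by (auto simp: i_def)
    have vi: "v i x = D j y"
    proof (cases "j = 0")
      case True
      then have si: "Suc i = N" using N by (simp add: i_def)
      (* The falling part of the last bump is parametrised one turn later than y. *)
      then have "v i (turn (y + 1)) = D' i (y + 1)" using v(2)[of i "y + 1"] yj True tN by (simp add: e_def)
      then show ?thesis using y True si by (simp add: D'_def)
    next
      case False
      then have "Suc i = j" by (simp add: i_def)
      then show ?thesis using v(2)[of i y] yj jN y i by (simp add: e_def D'_def)
    qed
    have vj: "v j x = R j y" using v(1)[OF jN yj] y by simp
    have v0: "v k x = 0" if k: "k < N" "k \<noteq> i" "k \<noteq> j" for k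
    proof (cases "k < j")
      case True
      then have "Suc k < j" using k by (auto simp: i_def split: if_splits)
      then have "e k \<le> y" using t_mono[of "Suc (Suc k)" j] jN yj by (simp add: e_def)
      moreover have "y \<le> t k + 1" using y t_mono[of 0 k] k by simp
      ultimately show ?thesis using v(3)[OF k(1)] y by simp
    next
      case False
      then have jk: "Suc j \<le> k" using k by simp
      then have "t (Suc j) \<le> t k" using k by (intro t_mono) auto
      then have "y + 1 \<le> t k + 1" using yj by simp
      moreover have "e k \<le> y + 1"
      proof (cases "Suc k < N")
        case True
        then show ?thesis using t_mono[of "Suc (Suc k)" N] y tN by (simp add: e_def)
      next
        case False
        then have "k = N - 1" using k by simp
        then have "j \<noteq> 0" using k(2) by (metis i_def)
        then show ?thesis using False t_mono[of 1 j] jN yj by (simp add: e_def)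
      qed
      (* For k > j the point y lies before t k, so it is looked up one turn later. *)
      ultimately have "v k (turn (y + 1)) = 0" using v(3)[OF k(1), of "y + 1"] by simp
      then show ?thesis using y by simp
    qed
    have "(\<Sum>k<N. v k x) = (\<Sum>k\<in>{i, j}. v k x)"
      using i jN v0 by (intro sum.mono_neutral_right) auto
    also have "\<dots> = D j y + R j y" using i vi vj by simp
    finally show ?thesis using FDR[OF jN yj] y by simp
  qed
  define K where "K = {k \<in> {..<N}. 0 < R k (t (Suc k))}"
  show ?thesis
  proof (rule that[of K v])
    show "finite K" by (simp add: K_def)
    have "card K \<le> card {..<N}" by (intro card_mono) (auto simp: K_def)
    then show "card K \<le> N" by simp
    show "unimodal (top_of_set S1) (v k)" if "k \<in> K" for k using v(5) that by (auto simp: K_def)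
    fix x assume x: "x \<in> S1"
    have "(\<Sum>k\<in>K. v k x) = (\<Sum>k<N. v k x)"
    proof (intro sum.mono_neutral_left ballI)
      fix k assume "k \<in> {..<N} - K"
      then show "v k x = 0" using v(4)[OF _ x, of k] by (auto simp: K_def)
    qed (auto simp: K_def)
    then show "F x = (\<Sum>k\<in>K. v k x)" using total[OF x] by simp
  qed
qed

text \<open>
  The extra last entry closes the cycle, so that the last arc, which may cross 0, is treated like
  the others.
\<close>

lemma cyclic_enumeration:
  fixes T :: "real set"
  assumes "finite T" "T \<noteq> {}" "T \<subseteq> {0..<1}"
  obtains t :: "nat \<Rightarrow> real" where "\<And>k. k < card T \<Longrightarrow> t k < t (Suc k)" "t (card T) = t 0 + 1"
    "\<And>k. k < card T \<Longrightarrow> t (Suc k) \<le> t k + 1"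
    "\<And>k y. k < card T \<Longrightarrow> t k < y \<Longrightarrow> y < t (Suc k) \<Longrightarrow> frac y \<notin> T"
proof -
  define L where "L = sorted_list_of_set T"
  have L: "sorted_wrt (<) L" "set L = T" "length L = card T" using assms unfolding L_def by auto
  have N: "0 < card T" using assms by (simp add: card_gt_0_iff)
  define t where "t = (\<lambda>k. if k < card T then L ! k else L ! 0 + 1)"
  have tT: "t k \<in> T" if "k < card T" for k using L that by (auto simp: t_def)
  have less: "t j < t k" if "j < k" "k < card T" for j k
  proof -
    have "L ! j < L ! k" using that by (intro sorted_wrt_nth_less[OF L(1)]) (simp_all add: L(3))
    then show ?thesis using that by (simp add: t_def)
  qed
  have ran: "0 \<le> t k" "t k < 1" if "k < card T" for k using tT[OF that] assms by auto
  have idx: "\<exists>j<card T. t j = z" if "z \<in> T" for z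
  proof -
    have "z \<in> set L" using that L(2) by simp
    then obtain j where "j < card T" "L ! j = z" unfolding in_set_conv_nth L(3) by blast
    then show ?thesis by (auto simp: t_def)
  qed
  show ?thesis
  proof (rule that[of t])
    show last: "t (card T) = t 0 + 1" using N by (simp add: t_def)
    show "t k < t (Suc k)" if k: "k < card T" for k
    proof (cases "Suc k < card T")
      case False
      then have "Suc k = card T" using k by simp
      then show ?thesis using last ran[OF N] ran[OF k] by simp
    qed (rule less, auto)
    show "t (Suc k) \<le> t k + 1" if k: "k < card T" for k
    proof (cases "Suc k < card T")
      case True
      then show ?thesis using ran(2)[OF True] ran(1)[OF k] by simp
    next
      case False
      then have "Suc k = card T" using k by simp
      moreover have "t 0 \<le> t k" using less[of 0 k] k by (cases "k = 0") auto
      ultimately show ?thesis using last by simp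
    qed
    fix k y assume k: "k < card T" and y: "t k < y" "y < t (Suc k)"
    show "frac y \<notin> T"
    proof
      assume "frac y \<in> T"
      then obtain j where j: "j < card T" "t j = frac y" using idx by blast
      show False
      proof (cases "y < 1")
        case True
        then have "t j = y" using ran[OF k] y j(2) by (simp add: frac_eq)
        then have "\<not> j \<le> k" using y less[of j k] k by (cases "j = k") auto
        then show False using y less[of "Suc k" j] j \<open>t j = y\<close> by (cases "Suc k = j") auto
      next
        case False
        have "\<not> Suc k < card T" using ran(2)[of "Suc k"] y False by auto
        then have "Suc k = card T" using k by simp
        then have y0: "y < t 0 + 1" using y last by simp
        then have "frac y = y - 1" using False ran[OF N] by (intro frac_unique_iff[THEN iffD2]) auto
        then have "t j < t 0" using j y0 by simp
        then show False using less[of 0 j] j by (cases "j = 0") auto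
      qed
    qed
  qed
qed

section \<open>Comparing decompositions\<close>

text \<open>
  The bumps peak at the cut points. It does no harm to cut at more points than those in \<open>P\<close>, since
  shorter arcs still avoid \<open>P\<close>; taking exactly \<open>n\<close> cuts guarantees the two arcs that gluing needs
  even if \<open>P\<close> is a single point.
\<close>

lemma fall_rise_off_points_imp_sum_of_unimodal:
  fixes F :: "complex \<Rightarrow> real"
  assumes "2 \<le> n" "finite P" "card P \<le> n"
    and F: "\<And>s t. s < t \<Longrightarrow> t \<le> s + 1 \<Longrightarrow> \<forall>x\<in>{s<..<t}. turn x \<notin> P \<Longrightarrow> fall_rise_sum s t (\<lambda>x. F (turn x))"
  obtains K v where "finite K" "card K \<le> n" "\<And>k. k \<in> K \<Longrightarrow> unimodal (top_of_set S1) (v k)"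
    "\<And>x. x \<in> S1 \<Longrightarrow> F x = (\<Sum>k\<in>K. v (k::nat) x)"
proof -
  define T0 where "T0 = {y \<in> {0..<1}. turn y \<in> P}"
  have inj: "inj_on turn T0" by (rule inj_on_subset[OF inj_on_turn[of 0]]) (auto simp: T0_def)
  have im: "turn ` T0 \<subseteq> P" by (auto simp: T0_def)
  have T0: "finite T0" "card T0 \<le> n"
    using inj_on_finite[OF inj im assms(2)] card_inj_on_le[OF inj im assms(2)] assms(3) by auto
  have "infinite ({0..<1} - T0)" using T0(1) by (simp add: infinite_Ico)
  then obtain B where B: "finite B" "card B = n - card T0" "B \<subseteq> {0..<1} - T0"
    using infinite_arbitrarily_large by blast
  define T where "T = T0 \<union> B"
  have "T0 \<inter> B = {}" using B by auto
  then have cT: "card T = n" using T0 B by (simp add: T_def card_Un_disjoint)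
  have T: "finite T" "T \<subseteq> {0..<1}" "T0 \<subseteq> T"
    using T0 B by (auto simp: T_def T0_def)
  have "T \<noteq> {}" using cT assms(1) by auto
  obtain t where t: "\<And>k. k < card T \<Longrightarrow> t k < t (Suc k)" "t (card T) = t 0 + 1"
    "\<And>k. k < card T \<Longrightarrow> t (Suc k) \<le> t k + 1"
    "\<And>k y. k < card T \<Longrightarrow> t k < y \<Longrightarrow> y < t (Suc k) \<Longrightarrow> frac y \<notin> T"
    by (rule cyclic_enumeration[OF T(1) \<open>T \<noteq> {}\<close> T(2)]) blast
  have "fall_rise_sum (t k) (t (Suc k)) (\<lambda>x. F (turn x))" if k: "k < n" for k
  proof (rule F)
    show "t k < t (Suc k)" "t (Suc k) \<le> t k + 1" using t k cT by auto
    show "\<forall>x\<in>{t k<..<t (Suc k)}. turn x \<notin> P"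
    proof
      fix x assume "x \<in> {t k<..<t (Suc k)}"
      then have "frac x \<notin> T0" using t(4)[of k x] k cT T(3) by auto
      moreover have "turn (frac x) = turn x" unfolding turn_eq_iff frac_def
        by (rule exI[of _ "- \<lfloor>x\<rfloor>"]) simp
      ultimately show "turn x \<notin> P" using frac_lt_1[of x] by (auto simp: T0_def)
    qed
  qed
  from sum_of_bumps[OF assms(1) t(1,2)[unfolded cT] this] that show ?thesis by blast
qed

text \<open>
  Cut at one peak of each \<open>u i\<close>. Between the cuts \<open>f powr p1\<close> is the power \<open>p1 / p2 < 1\<close> of
  \<open>\<Sum>i. u i powr p2\<close>, a sum of valleys (or a power of a valley if \<open>p2 = \<infinity>\<close>).
\<close>

lemma unimodal_decomposition_powr_mono:
  fixes f :: "complex \<Rightarrow> real" and p1 p2 :: ennreal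
  assumes f: "continuous_on S1 f" "\<forall>x\<in>S1. 0 \<le> f x"
    and p: "0 < p1" "p1 < p2"
    and dec: "unimodal_decomposition p2 (top_of_set S1) f n u" and n: "2 \<le> n"
  obtains n' u' where "n' \<le> n" "unimodal_decomposition p1 (top_of_set S1) f n' u'"
proof -
  define p where "p = enn2real p1"
  have p1: "p1 \<noteq> \<infinity>" "0 < p" using p by (auto simp: p_def enn2real_positive_iff less_top[symmetric])
  have u: "\<And>i. i \<in> {1..n} \<Longrightarrow> unimodal (top_of_set S1) (u i)"
    and fu: "\<And>x. x \<in> S1 \<Longrightarrow> f x = (if p2 = \<infinity> then Max (insert 0 ((\<lambda>i. u i x) ` {1..n}))
               else (\<Sum>i=1..n. u i x powr enn2real p2) powr (1 / enn2real p2))"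
    using dec unfolding unimodal_decomposition_def by auto
  have "\<exists>m\<in>S1. \<forall>s t. t \<le> s + 1 \<longrightarrow> (\<forall>x\<in>{s<..<t}. turn x \<noteq> m) \<longrightarrow> valley_on s t (\<lambda>x. u i (turn x))"
    if "i \<in> {1..n}" for i
    by (rule unimodal_valley[OF u[OF that]]) blast
  then obtain m where m: "\<And>i s t. i \<in> {1..n} \<Longrightarrow> t \<le> s + 1 \<Longrightarrow> (\<forall>x\<in>{s<..<t}. turn x \<noteq> m i) \<Longrightarrow>
      valley_on s t (\<lambda>x. u i (turn x))"
    by metis
  have u0: "0 \<le> u i x" if "i \<in> {1..n}" "x \<in> S1" for i x
    using u[OF that(1)] that(2) by (auto simp: unimodal_def)
  have uc: "continuous_on {s..t} (\<lambda>x. u i (turn x))" if "i \<in> {1..n}" for i s t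
  proof (rule continuous_on_compose2[of S1 "u i"])
    show "continuous_on S1 (u i)" using u[OF that] by (simp add: unimodal_def)
  qed (auto intro!: continuous_intros)
  have fc: "continuous_on {s..t} (\<lambda>x. f (turn x))" for s t
    by (rule continuous_on_compose2[OF f(1)]) (auto intro!: continuous_intros)
  have split: "fall_rise_sum s t (\<lambda>x. f (turn x) powr p)"
    if st: "s < t" "t \<le> s + 1" "\<forall>x\<in>{s<..<t}. turn x \<notin> m ` {1..n}" for s t
  proof -
    have val: "valley_on s t (\<lambda>x. u i (turn x))" if "i \<in> {1..n}" for i
      using m[OF that st(2)] st(3) that by blast
    show ?thesis
    proof (cases "p2 = \<infinity>")
      case True
      have fmax: "f (turn x) = Max ((\<lambda>i. u i (turn x)) ` {1..n})" for x
      proof -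
        have "u 1 (turn x) \<in> (\<lambda>i. u i (turn x)) ` {1..n}" using n by auto
        then have "u 1 (turn x) \<le> Max ((\<lambda>i. u i (turn x)) ` {1..n})" by (intro Max_ge) auto
        moreover have "0 \<le> u 1 (turn x)" using n by (intro u0) auto
        ultimately have "0 \<le> Max ((\<lambda>i. u i (turn x)) ` {1..n})" by linarith
        then show ?thesis using fu[of "turn x"] True n by (simp add: max_absorb2)
      qed
      have "valley_on s t (\<lambda>x. f (turn x))"
        unfolding fmax using n val by (intro valley_on_Max) auto
      then have "valley_on s t (\<lambda>x. f (turn x) powr p)"
        using f(2) p1 by (intro valley_on_powr) auto
      moreover have "continuous_on {s..t} (\<lambda>x. f (turn x) powr p)"
        using fc f(2) p1 by (intro continuous_on_powr' continuous_on_const) auto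
      ultimately show ?thesis using st(1) by (intro valley_imp_fall_rise_sum) auto
    next
      case False
      define q where "q = enn2real p2"
      have "ennreal p = p1" "ennreal q = p2"
        using p1 False by (simp_all add: p_def q_def less_top)
      then have q: "p < q" using p(2) p1(2) ennreal_less_iff[of p q] by simp
      have "fall_rise_sum s t (\<lambda>x. u i (turn x) powr q)" if i: "i \<in> {1..n}" for i
      proof (rule valley_imp_fall_rise_sum)
        show "continuous_on {s..t} (\<lambda>x. u i (turn x) powr q)"
          using uc[OF i] u0[OF i] p1 q by (intro continuous_on_powr' continuous_on_const) auto
        show "valley_on s t (\<lambda>x. u i (turn x) powr q)"
          using val[OF i] u0[OF i] p1 q by (intro valley_on_powr) auto
      qed (use st in auto)
      then have "fall_rise_sum s t (\<lambda>x. \<Sum>i=1..n. u i (turn x) powr q)"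
        by (rule fall_rise_sum_sum)
      then have "fall_rise_sum s t (\<lambda>x. (\<Sum>i=1..n. u i (turn x) powr q) powr (p / q))"
        using p1 q by (intro fall_rise_sum_powr) auto
      moreover have "(\<Sum>i=1..n. u i (turn x) powr q) powr (p / q) = f (turn x) powr p" for x
        using fu[of "turn x"] False by (simp add: powr_powr q_def)
      ultimately show ?thesis by simp
    qed
  qed
  have cm: "card (m ` {1..n}) \<le> n" using card_image_le[of "{1..n}" m] by simp
  obtain K v where K: "finite K" "card K \<le> n" "\<And>k. k \<in> K \<Longrightarrow> unimodal (top_of_set S1) (v k)"
    "\<And>x. x \<in> S1 \<Longrightarrow> f x powr p = (\<Sum>k\<in>K. v (k::nat) x)"
    by (rule fall_rise_off_points_imp_sum_of_unimodal[OF n _ cm split]) auto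
  obtain h where h: "bij_betw h {1..card K} K" using ex_bij_betw_nat_finite_1[OF K(1)] by blast
  have hK: "h i \<in> K" if "i \<in> {1..card K}" for i using h that by (auto simp: bij_betw_def)
  have "unimodal_decomposition p1 (top_of_set S1) f (card K) (\<lambda>i x. v (h i) x powr (1 / p))"
    unfolding unimodal_decomposition_def
  proof (intro conjI ballI)
    show "unimodal (top_of_set S1) (\<lambda>x. v (h i) x powr (1 / p))" if "i \<in> {1..card K}" for i
      using K(3)[OF hK[OF that]] p1 by (intro unimodal_powr) auto
    fix x assume "x \<in> topspace (top_of_set S1)"
    then have x: "x \<in> S1" by simp
    have "(\<Sum>i=1..card K. (v (h i) x powr (1 / p)) powr p) = (\<Sum>i=1..card K. v (h i) x)"
    proof (rule sum.cong)
      fix i assume i: "i \<in> {1..card K}"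
      have "0 \<le> v (h i) x" using K(3)[OF hK[OF i]] x by (auto simp: unimodal_def)
      then show "(v (h i) x powr (1 / p)) powr p = v (h i) x" using p1 by (simp add: powr_powr)
    qed simp
    also have "\<dots> = (\<Sum>k\<in>K. v k x)" by (rule sum.reindex_bij_betw[OF h])
    also have "\<dots> = f x powr p" using K(4)[OF x] by simp
    finally have "(\<Sum>i=1..card K. (v (h i) x powr (1 / p)) powr p) powr (1 / p) = f x"
      using p1 f(2) x by (simp add: powr_powr)
    then show "f x = (if p1 = \<infinity> then Max (insert 0 ((\<lambda>i. v (h i) x powr (1 / p)) ` {1..card K}))
        else (\<Sum>i=1..card K. (v (h i) x powr (1 / p)) powr enn2real p1) powr (1 / enn2real p1))"
      using p1 by (simp add: p_def)
  qed
  then show ?thesis using that K(2) by blast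
qed

text \<open>
  With a single summand every exponent gives \<open>f = u 1\<close>. This case is separate because cutting the
  circle at one point only leaves a single arc, on which the falling and the rising part overlap
  and do not form a bump.
\<close>

lemma unimodal_decomposition_at_most_one:
  assumes dec: "unimodal_decomposition p X f n u" and n: "n \<le> 1" and pq: "0 < p" "0 < q" "q \<noteq> \<infinity>"
  shows "unimodal_decomposition q X f n u"
proof (cases "n = 0")
  case True
  then show ?thesis using dec by (auto simp: unimodal_decomposition_def)
next
  case False
  then have n1: "n = 1" using n by simp
  have pos: "0 < enn2real r" if "0 < r" "r \<noteq> \<infinity>" for r :: ennreal
    using that by (auto simp: enn2real_positive_iff less_top[symmetric])
  have u0: "0 \<le> u 1 x" if "x \<in> topspace X" for x
    using dec that by (auto simp: unimodal_decomposition_def unimodal_def n1)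
  have fu: "f x = u 1 x" if x: "x \<in> topspace X" for x
  proof -
    have "f x = (if p = \<infinity> then Max {0, u 1 x} else (u 1 x powr enn2real p) powr (1 / enn2real p))"
      using dec x by (simp add: unimodal_decomposition_def n1)
    then show ?thesis using u0[OF x] pos[OF pq(1)] by (simp add: powr_powr split: if_splits)
  qed
  have "f x = (u 1 x powr enn2real q) powr (1 / enn2real q)" if "x \<in> topspace X" for x
    using fu[OF that] u0[OF that] pos[OF pq(2,3)] by (simp add: powr_powr)
  moreover have "unimodal X (u 1)" using dec by (simp add: unimodal_decomposition_def n1)
  ultimately show ?thesis using pq(3) by (simp add: unimodal_decomposition_def n1)
qed

theorem corollary4p6:
  fixes f :: "complex \<Rightarrow> real" and p1 p2 :: ennreal
  assumes "continuous_on S1 f"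
    and "\<forall>x\<in>S1. 0 \<le> f x"
    and "circle_bounded_variation f"
    and "0 < p1" and "p1 < p2" and "p2 \<le> \<infinity>"
  shows "ucat p1 (top_of_set S1) f \<le> ucat p2 (top_of_set S1) f"
  unfolding ucat_def
proof (rule Inf_greatest)
  fix N assume "N \<in> {enat n |n. \<exists>u. unimodal_decomposition p2 (top_of_set S1) f n u}"
  then obtain n u where N: "N = enat n" and dec: "unimodal_decomposition p2 (top_of_set S1) f n u"
    by blast
  obtain n' u' where n': "n' \<le> n" "unimodal_decomposition p1 (top_of_set S1) f n' u'"
  proof (cases "2 \<le> n")
    case True
    then show thesis
      using unimodal_decomposition_powr_mono[OF assms(1,2,4,5) dec] that by blast
  next
    case False
    have "unimodal_decomposition p1 (top_of_set S1) f n u"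
      by (rule unimodal_decomposition_at_most_one[OF dec]) (use False assms in auto)
    then show thesis using that by blast
  qed
  then have "Inf {enat n |n. \<exists>u. unimodal_decomposition p1 (top_of_set S1) f n u} \<le> enat n'"
    by (intro Inf_lower) blast
  also have "\<dots> \<le> N" using N n' by simp
  finally show "Inf {enat n |n. \<exists>u. unimodal_decomposition p1 (top_of_set S1) f n u} \<le> N" .
qed

end
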